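(* There is a signature $\sigma=\sigma_{\mathcal B}\sqcup\sigma_{\mathcal D}$ where $\sigma_{\mathcal D}$ consists of a single strict linear order relation, a CQ $Q$ on $\sigma$, and a set $\Sigma$ of inclusion dependencies on $\sigma_{\mathcal B}$, such that the following problem is undecidable: given a finite set of facts $\mathcal F_0$, decide $\mathsf{QA}^{\mathrm{lin}}(\mathcal F_0,\Sigma,Q)$.
   Context: Sets of facts may be finite or infinite; constraints and queries are first-order sentences with equality and without constants. $\mathsf{QA}^{\mathrm{lin}}(\mathcal F_0,\Sigma,Q)$ holds iff there is no $\mathcal F\supseteq\mathcal F_0$ (finite or infinite) satisfying $\Sigma\wedge\neg Q$ in which every distinguished relation is a strict linear order on the elements of $\mathcal F$. An inclusion dependency is $\forall\vec x\,(R(\vec x)\to\exists\vec y\,T(\vec x,\vec y))$ with no variable repeated in an atom. *)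

theory Defs
  imports Main "HOL-Library.Nat_Bijection"
begin

section \<open>First-order logic without constants over relational signatures\<close>

text \<open>Relation symbols and variables are natural numbers; a signature maps its relation
  symbols to their arities.\<close>

type_synonym signature = "nat \<rightharpoonup> nat"

datatype fm =
    Atom nat "nat list"
  | Eq nat nat
  | Neg fm
  | And fm fm
  | Or fm fm
  | Imp fm fm
  | Ex nat fm
  | All nat fm

definition Exs :: "nat list \<Rightarrow> fm \<Rightarrow> fm" where
  "Exs xs \<phi> = foldr Ex xs \<phi>"

definition Alls :: "nat list \<Rightarrow> fm \<Rightarrow> fm" where
  "Alls xs \<phi> = foldr All xs \<phi>"

fun fv :: "fm \<Rightarrow> nat set" where
  "fv (Atom R xs) = set xs"
| "fv (Eq x y) = {x, y}"
| "fv (Neg \<phi>) = fv \<phi>"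
| "fv (And \<phi> \<psi>) = fv \<phi> \<union> fv \<psi>"
| "fv (Or \<phi> \<psi>) = fv \<phi> \<union> fv \<psi>"
| "fv (Imp \<phi> \<psi>) = fv \<phi> \<union> fv \<psi>"
| "fv (Ex x \<phi>) = fv \<phi> - {x}"
| "fv (All x \<phi>) = fv \<phi> - {x}"

fun fm_over :: "signature \<Rightarrow> fm \<Rightarrow> bool" where
  "fm_over \<sigma> (Atom R xs) \<longleftrightarrow> \<sigma> R = Some (length xs)"
| "fm_over \<sigma> (Eq x y) \<longleftrightarrow> True"
| "fm_over \<sigma> (Neg \<phi>) \<longleftrightarrow> fm_over \<sigma> \<phi>"
| "fm_over \<sigma> (And \<phi> \<psi>) \<longleftrightarrow> fm_over \<sigma> \<phi> \<and> fm_over \<sigma> \<psi>"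
| "fm_over \<sigma> (Or \<phi> \<psi>) \<longleftrightarrow> fm_over \<sigma> \<phi> \<and> fm_over \<sigma> \<psi>"
| "fm_over \<sigma> (Imp \<phi> \<psi>) \<longleftrightarrow> fm_over \<sigma> \<phi> \<and> fm_over \<sigma> \<psi>"
| "fm_over \<sigma> (Ex x \<phi>) \<longleftrightarrow> fm_over \<sigma> \<phi>"
| "fm_over \<sigma> (All x \<phi>) \<longleftrightarrow> fm_over \<sigma> \<phi>"

definition sentence_over :: "signature \<Rightarrow> fm \<Rightarrow> bool" where
  "sentence_over \<sigma> \<phi> \<longleftrightarrow> fm_over \<sigma> \<phi> \<and> fv \<phi> = {}"

fun conj_of_atoms :: "fm \<Rightarrow> bool" where
  "conj_of_atoms (Atom R xs) \<longleftrightarrow> True"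
| "conj_of_atoms (And \<phi> \<psi>) \<longleftrightarrow> conj_of_atoms \<phi> \<and> conj_of_atoms \<psi>"
| "conj_of_atoms _ \<longleftrightarrow> False"

text \<open>Conjunctive queries are Boolean, and their atoms are relational (no equalities).\<close>

definition cq_over :: "signature \<Rightarrow> fm \<Rightarrow> bool" where
  "cq_over \<sigma> \<phi> \<longleftrightarrow> sentence_over \<sigma> \<phi> \<and> (\<exists>xs \<psi>. \<phi> = Exs xs \<psi> \<and> conj_of_atoms \<psi>)"

text \<open>In \<open>\<forall>xs. R(xs) \<longrightarrow> (\<exists>ys. T(zs))\<close> the head may export any subset of the variables \<open>xs\<close>,
  and the exported variables and those of \<open>ys\<close> may be placed in any order.\<close>

definition inclusion_dependency_over :: "signature \<Rightarrow> fm \<Rightarrow> bool" where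
  "inclusion_dependency_over \<sigma> \<phi> \<longleftrightarrow> sentence_over \<sigma> \<phi> \<and>
     (\<exists>R T xs ys zs. \<phi> = Alls xs (Imp (Atom R xs) (Exs ys (Atom T zs))) \<and>
        distinct xs \<and> distinct ys \<and> distinct zs \<and>
        set xs \<inter> set ys = {} \<and> set ys \<subseteq> set zs \<and> set zs \<subseteq> set xs \<union> set ys)"


section \<open>Sets of facts\<close>

type_synonym 'a fact = "nat \<times> 'a list"

definition fact_over :: "signature \<Rightarrow> 'a fact \<Rightarrow> bool" where
  "fact_over \<sigma> \<alpha> \<longleftrightarrow> \<sigma> (fst \<alpha>) = Some (length (snd \<alpha>))"

definition elems :: "'a fact set \<Rightarrow> 'a set" where
  "elems F = (\<Union>\<alpha>\<in>F. set (snd \<alpha>))"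

text \<open>Quantifiers range over the elements that occur in the set of facts.\<close>

fun sat :: "'a fact set \<Rightarrow> (nat \<Rightarrow> 'a) \<Rightarrow> fm \<Rightarrow> bool" where
  "sat F v (Atom R xs) \<longleftrightarrow> (R, map v xs) \<in> F"
| "sat F v (Eq x y) \<longleftrightarrow> v x = v y"
| "sat F v (Neg \<phi>) \<longleftrightarrow> \<not> sat F v \<phi>"
| "sat F v (And \<phi> \<psi>) \<longleftrightarrow> sat F v \<phi> \<and> sat F v \<psi>"
| "sat F v (Or \<phi> \<psi>) \<longleftrightarrow> sat F v \<phi> \<or> sat F v \<psi>"
| "sat F v (Imp \<phi> \<psi>) \<longleftrightarrow> (sat F v \<phi> \<longrightarrow> sat F v \<psi>)"
| "sat F v (Ex x \<phi>) \<longleftrightarrow> (\<exists>a\<in>elems F. sat F (v(x := a)) \<phi>)"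
| "sat F v (All x \<phi>) \<longleftrightarrow> (\<forall>a\<in>elems F. sat F (v(x := a)) \<phi>)"

text \<open>Used for sentences only, where the choice of the valuation is irrelevant.\<close>

definition satisfies :: "'a fact set \<Rightarrow> fm \<Rightarrow> bool" where
  "satisfies F \<phi> \<longleftrightarrow> (\<forall>v. sat F v \<phi>)"

definition rel_of :: "'a fact set \<Rightarrow> nat \<Rightarrow> ('a \<times> 'a) set" where
  "rel_of F R = {(a, b). (R, [a, b]) \<in> F}"

definition QA_lin ::
  "signature \<Rightarrow> signature \<Rightarrow> 'a fact set \<Rightarrow> fm set \<Rightarrow> fm \<Rightarrow> bool" where
  "QA_lin \<sigma>B \<sigma>D F\<^sub>0 C Q \<longleftrightarrow>
     \<not> (\<exists>F. F\<^sub>0 \<subseteq> F \<and> (\<forall>\<alpha>\<in>F. fact_over (\<sigma>B ++ \<sigma>D) \<alpha>) \<and>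
            (\<forall>\<phi>\<in>C. satisfies F \<phi>) \<and> satisfies F (Neg Q) \<and>
            (\<forall>R\<in>dom \<sigma>D. strict_linear_order_on (elems F) (rel_of F R)))"


section \<open>Decidability\<close>

text \<open>Partial recursive functions. \<open>rec_eval f xs y\<close> means that \<open>f\<close> is defined on \<open>xs\<close> with
  value \<open>y\<close>. The recursion argument of \<open>Prec\<close> and the search argument of \<open>Mu\<close> come first.\<close>

datatype recf =
    Zero
  | Succ
  | Proj nat
  | Comp recf "recf list"
  | Prec recf recf
  | Mu recf

inductive rec_eval :: "recf \<Rightarrow> nat list \<Rightarrow> nat \<Rightarrow> bool" where
  Zero: "rec_eval Zero xs 0"
| Succ: "rec_eval Succ [x] (Suc x)"
| Proj: "i < length xs \<Longrightarrow> rec_eval (Proj i) xs (xs ! i)"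
| Comp: "list_all2 (\<lambda>g y. rec_eval g xs y) gs ys \<Longrightarrow> rec_eval f ys z \<Longrightarrow>
    rec_eval (Comp f gs) xs z"
| Prec_0: "rec_eval f xs z \<Longrightarrow> rec_eval (Prec f g) (0 # xs) z"
| Prec_Suc: "rec_eval (Prec f g) (n # xs) y \<Longrightarrow> rec_eval g (n # y # xs) z \<Longrightarrow>
    rec_eval (Prec f g) (Suc n # xs) z"
| Mu: "rec_eval f (n # xs) 0 \<Longrightarrow> (\<And>m. m < n \<Longrightarrow> \<exists>y>0. rec_eval f (m # xs) y) \<Longrightarrow>
    rec_eval (Mu f) xs n"

definition decidable_via :: "('i \<Rightarrow> nat) \<Rightarrow> 'i set \<Rightarrow> ('i \<Rightarrow> bool) \<Rightarrow> bool" where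
  "decidable_via enc I P \<longleftrightarrow> (\<exists>f. \<forall>x\<in>I. rec_eval f [enc x] (if P x then 1 else 0))"

text \<open>A finite set of facts is presented to an algorithm as a list of its facts, the elements
  being named by natural numbers.\<close>

definition encode_facts :: "nat fact list \<Rightarrow> nat" where
  "encode_facts fs = list_encode (map (\<lambda>(R, as). prod_encode (R, list_encode as)) fs)"

text \<open>The universe \<open>'a\<close> of sets of facts is arbitrary; \<open>e n\<close> is the element named by \<open>n\<close>.\<close>

definition facts_of :: "(nat \<Rightarrow> 'a) \<Rightarrow> nat fact list \<Rightarrow> 'a fact set" where
  "facts_of e fs = (\<lambda>(R, as). (R, map e as)) ` set fs"

definition QA_lin_decidable ::
  "(nat \<Rightarrow> 'a) \<Rightarrow> signature \<Rightarrow> signature \<Rightarrow> fm set \<Rightarrow> fm \<Rightarrow> bool" where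
  "QA_lin_decidable e \<sigma>B \<sigma>D C Q \<longleftrightarrow>
     decidable_via encode_facts {fs. \<forall>\<alpha>\<in>set fs. fact_over (\<sigma>B ++ \<sigma>D) \<alpha>}
       (\<lambda>fs. QA_lin \<sigma>B \<sigma>D (facts_of e fs) C Q)"

end

theory Submission
  imports Defs "HOL-Library.Countable"
begin

text \<open>Facts \<open>E(x, a, y)\<close> describe a graph with edges labelled by letters, the letters being elements
  as well. Inclusion dependencies make every node have an outgoing edge for every letter. As the
  order is total, the single CQ that asks for paths \<open>x a y b z\<close> and \<open>x c y' d z'\<close> with \<open>z < z'\<close>
  and an equation \<open>R(a, b, c, d)\<close> fails, for a symmetric set of equations, only if \<open>ab\<close> and
  \<open>cd\<close> always lead to the same node. Counterexamples to query answering are thus actions of a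
  finitely presented monoid, and the presentation, being data, may contain a program.

  A concatenative language on stacks of numbers (push, increment, fold, while, act below the top)
  has equations of this shape, e.g. \<open>Incr (Dip p) = (Dip p) Incr\<close>, and computes all partial
  recursive functions. Given a decision procedure, let the program \<open>D\<close> apply it to the very input
  that claims that \<open>D\<close> outputs 1. If the procedure answers 0, the equations identify the distinct
  nodes for the outputs 0 and 1, so there is no counterexample; if it answers 1, the semantics of the
  language is one. To obtain the self-reference, the input contains a path that encodes the number
  \<open>n\<close> of its remaining part, and \<open>D\<close> starts on \<open>n\<close>.\<close>

section \<open>A stack language computing all partial recursive functions\<close>

datatype prog = Nop | Push | Incr | Seq prog prog | Dip prog | Fold prog prog | While prog

instance prog :: countable
  by countable_datatype

text \<open>The clauses are chosen so that they become equations between two-letter words once the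
  number on top is spelled by \<open>Push\<close> and \<open>Incr\<close>. \<open>Fold p Nop\<close>
  discards that number and runs \<open>p\<close>, which makes the unrolling of a loop fit this
  format.\<close>

inductive run :: "prog \<Rightarrow> nat list \<Rightarrow> nat list \<Rightarrow> bool" where
  Nop: "run Nop s s"
| Push: "run Push s (0 # s)"
| Incr: "run Incr (n # s) (Suc n # s)"
| Seq: "run p s t \<Longrightarrow> run q t u \<Longrightarrow> run (Seq p q) s u"
| Dip: "run p s t \<Longrightarrow> run (Dip p) (n # s) (n # t)"
| Fold_0: "run p s t \<Longrightarrow> run (Fold p q) (0 # s) t"
| Fold_Suc: "run (Fold p q) (n # s) t \<Longrightarrow> run q t u \<Longrightarrow> run (Fold p q) (Suc n # s) u"
| While_0: "run (While p) (0 # s) s"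
| While_Suc: "run (Fold p Nop) (n # s) t \<Longrightarrow> run (While p) t u \<Longrightarrow> run (While p) (Suc n # s) u"

inductive_simps run_Nop_iff [simp]: "run Nop s t"
inductive_simps run_Push_iff [simp]: "run Push s t"
inductive_simps run_Incr_iff: "run Incr s t"
inductive_simps run_Incr_Cons_iff [simp]: "run Incr (n # s) t"
inductive_simps run_Seq_iff: "run (Seq p q) s t"
inductive_simps run_Dip_iff: "run (Dip p) s t"
inductive_simps run_Dip_Cons_iff: "run (Dip p) (n # s) t"
inductive_simps run_Fold_0_iff: "run (Fold p q) (0 # s) t"
inductive_simps run_Fold_Suc_iff: "run (Fold p q) (Suc n # s) t"
inductive_simps run_Fold_Nil_iff [simp]: "run (Fold p q) [] t"
inductive_simps run_While_0_iff: "run (While p) (0 # s) t"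
inductive_simps run_While_Suc_iff: "run (While p) (Suc n # s) t"

lemma run_functional: "run p s t \<Longrightarrow> run p s u \<Longrightarrow> t = u"
proof (induction arbitrary: u rule: run.induct)
  case (Seq p s t q u) then show ?case by (metis run_Seq_iff)
next
  case (Dip p s t n) then show ?case by (metis run_Dip_Cons_iff)
next
  case (Fold_Suc p q n s t u) then show ?case by (metis run_Fold_Suc_iff)
next
  case (While_Suc p n s t u) then show ?case by (metis run_While_Suc_iff)
qed (simp_all add: run_Fold_0_iff run_While_0_iff)

section \<open>Compilation of partial recursive functions into stack programs\<close>

definition "drop1 = Fold Nop Nop"
definition "dup = Fold (Seq Push Push) (Seq Incr (Dip Incr))"
definition "swap = Fold (Dip Push) (Dip Incr)"

primrec pick :: "nat \<Rightarrow> prog" where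
  "pick 0 = dup"
| "pick (Suc i) = Seq (Dip (pick i)) swap"

lemma run_drop1: "run drop1 (n # s) s"
  unfolding drop1_def by (induction n) (auto intro: run.intros)

lemma run_dup: "run dup (n # s) (n # n # s)"
  unfolding dup_def by (induction n) (blast intro: run.intros)+

lemma run_swap: "run swap (m # n # s) (n # m # s)"
  unfolding swap_def by (induction m) (blast intro: run.intros)+

lemma run_pick: "i < length s \<Longrightarrow> run (pick i) s (s ! i # s)"
proof (induction i arbitrary: s)
  case 0
  then show ?case by (cases s) (auto intro: run_dup)
next
  case (Suc i)
  then obtain x s' where s: "s = x # s'" "i < length s'" by (cases s) auto
  then show ?case using Suc.IH[of s'] run_swap by (auto intro!: run.Seq run.Dip)
qed

text \<open>Compiled programs leave their arguments on the stack, below the result; so the arity need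
  not be known.\<close>

fun compile :: "recf \<Rightarrow> prog" where
  "compile Zero = Push"
| "compile Succ = Seq dup Incr"
| "compile (Proj i) = pick i"
| "compile (Comp f gs) =
     Seq (foldr (\<lambda>g q. Seq g (Dip q)) (map compile gs) Nop)
       (Seq (compile f) (foldr (\<lambda>g q. Seq (Dip drop1) q) gs Nop))"
| "compile (Prec f g) =
     Fold (Seq (compile f) (Dip Push))
       (Seq swap (Seq (compile g) (Dip (Seq Incr (Dip drop1)))))"
| "compile (Mu f) =
     Seq Push (Seq (compile f) (While (Seq Incr (compile f))))"

lemma run_compile: "rec_eval f xs y \<Longrightarrow> run (compile f) (xs @ s) (y # xs @ s)"
proof (induction arbitrary: s rule: rec_eval.induct)
  case (Zero xs)
  show ?case by simp
next
  case (Succ x)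
  show ?case using run_dup[of x s] by (auto intro: run.intros)
next
  case (Proj i xs)
  then show ?case using run_pick[of i "xs @ s"] by (simp add: nth_append)
next
  case (Comp xs gs ys f z)
  \<comment> \<open>Nested \<open>Dip\<close>s compute every further argument beneath the earlier
    ones, so each \<open>g\<close> still finds \<open>xs\<close> on top.\<close>
  have args: "run (foldr (\<lambda>g q. Seq g (Dip q)) (map compile gs) Nop) (xs @ s) (ys @ xs @ s)"
    using Comp.IH(1) by (induction rule: list_all2_induct) (auto intro: run.intros)
  have "run (foldr (\<lambda>g q. Seq (Dip drop1) q) gs Nop) (z # ys @ xs @ s) (z # xs @ s)"
    using Comp.IH(1) by (induction rule: list_all2_induct) (auto intro: run.intros run_drop1)
  with args Comp.IH(2)[of "xs @ s"] show ?case by (auto intro: run.Seq)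
next
  case (Prec_0 f xs z g)
  then show ?case by (auto intro!: run.intros)
next
  case (Prec_Suc f g n xs y z)
  \<comment> \<open>\<open>Fold\<close> consumes its counter, so the program rebuilds it below the
    value: 0 at the start, then one \<open>Incr\<close> per round; the old value, lying beneath the
    counter, is dropped.\<close>
  have "run (Seq swap (Seq (compile g) (Dip (Seq Incr (Dip drop1)))))
      (y # n # xs @ s) (z # Suc n # xs @ s)"
    using Prec_Suc.IH(2)[of s] by (auto intro!: run.intros run_swap run_drop1)
  with Prec_Suc.IH(1)[of s] show ?case by (auto intro: run.Fold_Suc)
next
  case (Mu f n xs)
  let ?w = "While (Seq Incr (compile f))"
  \<comment> \<open>The candidate is \<open>n - k\<close>: the induction starts at the root
    \<open>n\<close> and goes down to 0, where the initial \<open>Push\<close> begins the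
    search.\<close>
  have loop: "run (Seq (compile f) ?w) ((n - k) # xs @ s) (n # xs @ s)" if "k \<le> n" for k
    using that
  proof (induction k)
    case 0
    then show ?case using Mu.IH(1)[of s] by (auto intro: run.intros)
  next
    case (Suc k)
    let ?m = "n - Suc k"
    from Suc.prems have m: "?m < n" "n - k = Suc ?m" by auto
    then obtain y where "y > 0" and y: "run (compile f) (?m # xs @ s) (y # ?m # xs @ s)"
      using Mu.IH(2)[of ?m] by auto
    then obtain y' where y': "y = Suc y'" by (cases y) auto
    have "run (Seq (compile f) ?w) (Suc ?m # xs @ s) (n # xs @ s)"
      using Suc m by simp
    then obtain t where t: "run (compile f) (Suc ?m # xs @ s) t" "run ?w t (n # xs @ s)"
      by (auto simp: run_Seq_iff)
    have "run (Fold (Seq Incr (compile f)) Nop) (y' # ?m # xs @ s) t"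
      using t(1) by (induction y') (auto intro: run.intros)
    with t(2) y y' show ?case by (blast intro: run.intros)
  qed
  show ?case using loop[of n] by (auto intro: run.intros)
qed

text \<open>Shorter sides are padded with \<open>Nop\<close> to length two. Unrolling
  \<open>While p\<close> produces \<open>Fold p Nop\<close>, which is not a subprogram, so its
  equations are added.\<close>

fun rules :: "prog \<Rightarrow> (prog \<times> prog \<times> prog \<times> prog) list" where
  "rules (Seq p q) = (Seq p q, Nop, p, q) # rules p @ rules q"
| "rules (Dip p) = (Push, Dip p, p, Push) # (Incr, Dip p, Dip p, Incr) # rules p"
| "rules (Fold p q) =
     (Push, Fold p q, p, Nop) # (Incr, Fold p q, Fold p q, q) # rules p @ rules q"
| "rules (While p) = (Push, While p, Nop, Nop) # (Incr, While p, Fold p Nop, While p) #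
     (Push, Fold p Nop, p, Nop) # (Incr, Fold p Nop, Fold p Nop, Nop) # rules p"
| "rules _ = []"

text \<open>Both sides agree as partial functions, domains included; this allows the model to send
  all undefined cases to one sink.\<close>

lemma rules_sound:
  "(a, b, c, d) \<in> set (rules p) \<Longrightarrow>
   (\<exists>t. run a s t \<and> run b t u) \<longleftrightarrow> (\<exists>t. run c s t \<and> run d t u)"
proof (induction p rule: rules.induct)
  case (1 p q) then show ?case by (auto simp: run_Seq_iff)
next
  case (2 p) then show ?case by (auto simp: run_Dip_iff run_Incr_iff)
next
  case (3 p q) then show ?case
    by (cases s) (auto simp: run_Fold_0_iff run_Fold_Suc_iff run_Incr_iff)
next
  case (4 p) then show ?case
    by (cases s)
      (auto simp: run_While_0_iff run_While_Suc_iff run_Fold_0_iff run_Fold_Suc_iff run_Incr_iff)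
qed auto


section \<open>Actions satisfying the rules\<close>

datatype letter = Link | Main | Code prog

instance letter :: countable
  by countable_datatype

fun code_rule :: "prog \<times> prog \<times> prog \<times> prog \<Rightarrow> letter \<times> letter \<times> letter \<times> letter" where
  "code_rule (a, b, c, d) = (Code a, Code b, Code c, Code d)"

text \<open>This is what is kept of a counterexample once the relational encoding is stripped off.
  \<open>commute\<close> makes \<open>Nop\<close> central, the substitute for its being an
  identity.\<close>

locale stack_action =
  fixes S :: "'n set" and L :: "letter set"
    and E :: "(letter \<times> letter \<times> letter \<times> letter) set"
    and act :: "'n \<Rightarrow> letter \<Rightarrow> 'n"
  assumes closed: "x \<in> S \<Longrightarrow> a \<in> L \<Longrightarrow> act x a \<in> S"
    and basic: "{Code Nop, Code Push, Code Incr} \<subseteq> L"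
    and letters: "(a, b, c, d) \<in> E \<Longrightarrow> {a, b, c, d} \<subseteq> L"
    and rule: "x \<in> S \<Longrightarrow> (a, b, c, d) \<in> E \<Longrightarrow> act (act x a) b = act (act x c) d"
    and commute: "x \<in> S \<Longrightarrow> a \<in> L \<Longrightarrow> act (act x a) (Code Nop) = act (act x (Code Nop)) a"
begin

abbreviation nop :: "'n \<Rightarrow> 'n" where "nop x \<equiv> act x (Code Nop)"

text \<open>The rules preserve length, so that \<open>Nop\<close> cannot act as the identity; it does so up to
  \<open>sim\<close>.\<close>

definition sim :: "'n \<Rightarrow> 'n \<Rightarrow> bool" where
  "sim x y \<longleftrightarrow> x \<in> S \<and> y \<in> S \<and> (\<exists>i j. (nop ^^ i) x = (nop ^^ j) y)"

lemma sim_refl: "x \<in> S \<Longrightarrow> sim x x"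
  unfolding sim_def by blast

lemma sim_sym: "sim x y \<Longrightarrow> sim y x"
  unfolding sim_def by (auto dest: sym)

lemma sim_trans [trans]:
  assumes "sim x y" "sim y z" shows "sim x z"
proof -
  obtain i j k l where S: "x \<in> S" "z \<in> S"
    and ij: "(nop ^^ i) x = (nop ^^ j) y" and kl: "(nop ^^ k) y = (nop ^^ l) z"
    using assms unfolding sim_def by blast
  \<comment> \<open>Powers of \<open>nop\<close> commute, so the two equations are joined by
    applying \<open>nop\<close> another \<open>k\<close> times to the first and \<open>j\<close>
    times to the second.\<close>
  have "(nop ^^ (k + i)) x = (nop ^^ (k + j)) y" using ij by (simp add: funpow_add)
  also have "\<dots> = (nop ^^ (j + l)) z"
    using kl by (subst add.commute) (simp add: funpow_add)
  finally show ?thesis using S unfolding sim_def by blast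
qed

lemma nop_funpow: "x \<in> S \<Longrightarrow> (nop ^^ i) x \<in> S"
  by (induction i) (use basic closed in auto)

lemma act_nop_funpow: "x \<in> S \<Longrightarrow> a \<in> L \<Longrightarrow> act ((nop ^^ i) x) a = (nop ^^ i) (act x a)"
proof (induction i)
  case (Suc i)
  then show ?case using commute[of "(nop ^^ i) x" a] nop_funpow by simp
qed simp

text \<open>Since \<open>Nop\<close> is central, a relation between prefixes of two words survives
  the letters that follow.\<close>

lemma sim_act: "sim x y \<Longrightarrow> a \<in> L \<Longrightarrow> sim (act x a) (act y a)"
  unfolding sim_def by (metis act_nop_funpow closed)

lemma sim_nop: "x \<in> S \<Longrightarrow> sim (nop x) x"
proof -
  assume "x \<in> S"
  moreover have "(nop ^^ 0) (nop x) = (nop ^^ 1) x" by simp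
  ultimately show ?thesis using closed basic unfolding sim_def by blast
qed

lemma sim_rule:
  "x \<in> S \<Longrightarrow> (a, b, c, d) \<in> E \<Longrightarrow> sim (act (act x a) b) (act (act x c) d)"
  using rule letters closed sim_refl by (metis insert_subset)

lemma sim_rule_nop_left:
  assumes "x \<in> S" "(a, Code Nop, c, d) \<in> E" shows "sim (act x a) (act (act x c) d)"
proof -
  have "act x a \<in> S" using letters[OF assms(2)] assms(1) closed by simp
  then show ?thesis using sim_rule[OF assms] sim_nop sim_sym sim_trans by blast
qed

lemma sim_rule_nop_right:
  assumes "x \<in> S" "(a, b, c, Code Nop) \<in> E" shows "sim (act (act x a) b) (act x c)"
proof -
  have "act x c \<in> S" using letters[OF assms(2)] assms(1) closed by simp
  then show ?thesis using sim_rule[OF assms] sim_nop sim_trans by blast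
qed

primrec stack :: "'n \<Rightarrow> nat list \<Rightarrow> 'n" where
  "stack x [] = x"
| "stack x (n # s) = ((\<lambda>y. act y (Code Incr)) ^^ n) (act (stack x s) (Code Push))"

lemma stack_Suc: "stack x (Suc n # s) = act (stack x (n # s)) (Code Incr)"
  by simp

lemma stack_closed: "x \<in> S \<Longrightarrow> stack x s \<in> S"
proof (induction s)
  case (Cons n s)
  then show ?case using basic by (induction n) (simp_all add: closed)
qed simp

lemma sim_run:
  assumes "x \<in> S"
  shows "run p s t \<Longrightarrow> code_rule ` set (rules p) \<subseteq> E \<Longrightarrow> sim (act (stack x s) (Code p)) (stack x t)"
proof (induction rule: run.induct)
  case (Nop s)
  then show ?case using sim_nop stack_closed assms by blast
next
  case (Push s)
  then show ?case using sim_refl stack_closed[OF assms, of "0 # s"] by simp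
next
  case (Incr n s)
  then show ?case using sim_refl stack_closed[OF assms, of "Suc n # s"] by simp
next
  case (Seq p s t q u)
  have E: "(Code (Seq p q), Code Nop, Code p, Code q) \<in> E" using Seq.prems by auto
  have "sim (act (stack x s) (Code (Seq p q))) (act (act (stack x s) (Code p)) (Code q))"
    using sim_rule_nop_left[OF _ E] stack_closed assms by blast
  also have "sim \<dots> (act (stack x t) (Code q))"
    using Seq.IH(1) Seq.prems letters[OF E] by (intro sim_act) auto
  also have "sim \<dots> (stack x u)" using Seq by auto
  finally show ?case .
next
  case (Dip p s t n)
  have E: "(Code Push, Code (Dip p), Code p, Code Push) \<in> E"
    "(Code Incr, Code (Dip p), Code (Dip p), Code Incr) \<in> E" using Dip.prems by auto
  have IH: "sim (act (stack x s) (Code p)) (stack x t)" using Dip by auto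
  \<comment> \<open>\<open>Dip p\<close> moves left past the letters \<open>Incr\<close> that spell
    \<open>n\<close>; at \<open>Push\<close> it turns into \<open>p\<close>.\<close>
  show ?case
  proof (induction n)
    case 0
    have "sim (act (stack x (0 # s)) (Code (Dip p))) (act (act (stack x s) (Code p)) (Code Push))"
      using sim_rule[OF _ E(1)] stack_closed assms by simp
    also have "sim \<dots> (act (stack x t) (Code Push))" using IH basic by (intro sim_act) auto
    finally show ?case by simp
  next
    case (Suc n)
    have "sim (act (stack x (Suc n # s)) (Code (Dip p)))
        (act (act (stack x (n # s)) (Code (Dip p))) (Code Incr))"
      unfolding stack_Suc using sim_rule[OF _ E(2)] stack_closed assms by blast
    also have "sim \<dots> (act (stack x (n # t)) (Code Incr))"
      using Suc basic by (intro sim_act) auto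
    finally show ?case by simp
  qed
next
  case (Fold_0 p s t q)
  have E: "(Code Push, Code (Fold p q), Code p, Code Nop) \<in> E" using Fold_0.prems by auto
  have "sim (act (stack x (0 # s)) (Code (Fold p q))) (act (stack x s) (Code p))"
    using sim_rule_nop_right[OF _ E] stack_closed assms by simp
  also have "sim \<dots> (stack x t)" using Fold_0 by auto
  finally show ?case .
next
  case (Fold_Suc p q n s t u)
  have E: "(Code Incr, Code (Fold p q), Code (Fold p q), Code q) \<in> E"
    using Fold_Suc.prems by auto
  have "sim (act (stack x (Suc n # s)) (Code (Fold p q)))
      (act (act (stack x (n # s)) (Code (Fold p q))) (Code q))"
    unfolding stack_Suc using sim_rule[OF _ E] stack_closed assms by blast
  also have "sim \<dots> (act (stack x t) (Code q))"
    using Fold_Suc.IH(1) Fold_Suc.prems letters[OF E] by (intro sim_act) auto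
  also have "sim \<dots> (stack x u)" using Fold_Suc by auto
  finally show ?case .
next
  case (While_0 p s)
  have E: "(Code Push, Code (While p), Code Nop, Code Nop) \<in> E" using While_0.prems by auto
  have "sim (act (stack x (0 # s)) (Code (While p))) (nop (stack x s))"
    using sim_rule_nop_right[OF _ E] stack_closed assms by simp
  also have "sim \<dots> (stack x s)" using sim_nop stack_closed assms by blast
  finally show ?case .
next
  case (While_Suc p n s t u)
  have E: "(Code Incr, Code (While p), Code (Fold p Nop), Code (While p)) \<in> E"
    using While_Suc.prems by auto
  have "sim (act (stack x (Suc n # s)) (Code (While p)))
      (act (act (stack x (n # s)) (Code (Fold p Nop))) (Code (While p)))"
    unfolding stack_Suc using sim_rule[OF _ E] stack_closed assms by blast
  also have "sim \<dots> (act (stack x t) (Code (While p)))"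
    using While_Suc.IH(1) While_Suc.prems letters[OF E] by (intro sim_act) auto
  also have "sim \<dots> (stack x u)" using While_Suc by auto
  finally show ?case .
qed

end


section \<open>The presentation of a program\<close>

text \<open>The order matters: these letters head every alphabet, so the predecessors of
  \<open>Code Incr\<close> and \<open>Main\<close> do not depend on the program, and neither does
  the function that computes the input.\<close>

definition basic_letters :: "letter list" where
  "basic_letters = [Link, Code Nop, Code Push, Code Incr, Main]"

text \<open>\<open>Main\<close> stands for \<open>D\<close> in the input. The function building the
  input will be a part of \<open>D\<close> and therefore cannot mention
  \<open>Code D\<close>.\<close>

definition equations :: "prog \<Rightarrow> (letter \<times> letter \<times> letter \<times> letter) list" where
  "equations D = (Main, Code Nop, Code D, Code Nop) # map code_rule (rules D)"

definition alphabet :: "prog \<Rightarrow> letter list" where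
  "alphabet D = basic_letters @ filter (\<lambda>a. a \<notin> set basic_letters)
     (remdups (concat (map (\<lambda>(a, b, c, d). [a, b, c, d]) (equations D))))"

text \<open>The query only detects \<open>z < z'\<close>, hence the exchange of sides. The next two
  lists make \<open>Nop\<close> central; the trivial equations say that equally labelled paths from
  one node end in the same node.\<close>

definition relators :: "prog \<Rightarrow> (letter \<times> letter \<times> letter \<times> letter) list" where
  "relators D = equations D @ map (\<lambda>(a, b, c, d). (c, d, a, b)) (equations D)
     @ map (\<lambda>a. (a, Code Nop, Code Nop, a)) (alphabet D)
     @ map (\<lambda>a. (Code Nop, a, a, Code Nop)) (alphabet D)
     @ concat (map (\<lambda>a. map (\<lambda>b. (a, b, a, b)) (alphabet D)) (alphabet D))"

text \<open>Dependencies cannot name letters. In a cyclic order they can demand all outgoing edges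
  of a node one after another, starting from any of them.\<close>

definition next_letter :: "prog \<Rightarrow> letter \<Rightarrow> letter" where
  "next_letter D a = the (map_of (zip (alphabet D) (rotate1 (alphabet D))) a)"

definition prev_letter :: "prog \<Rightarrow> letter \<Rightarrow> letter" where
  "prev_letter D a = the (map_of (zip (rotate1 (alphabet D)) (alphabet D)) a)"

lemma distinct_alphabet: "distinct (alphabet D)"
  by (auto simp: alphabet_def basic_letters_def)

lemma basic_letters_alphabet: "set basic_letters \<subseteq> set (alphabet D)"
  by (auto simp: alphabet_def)

lemma equations_alphabet:
  "(a, b, c, d) \<in> set (equations D) \<Longrightarrow> {a, b, c, d} \<subseteq> set (alphabet D)"
  by (force simp: alphabet_def)

lemma relators_iff:
  "(a, b, c, d) \<in> set (relators D) \<longleftrightarrow>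
     (a, b, c, d) \<in> set (equations D) \<or> (c, d, a, b) \<in> set (equations D) \<or>
     a \<in> set (alphabet D) \<and> b = Code Nop \<and> c = Code Nop \<and> d = a \<or>
     b \<in> set (alphabet D) \<and> a = Code Nop \<and> d = Code Nop \<and> c = b \<or>
     a \<in> set (alphabet D) \<and> b \<in> set (alphabet D) \<and> c = a \<and> d = b"
proof -
  have "(a, b, c, d) \<in> (\<lambda>(a, b, c, d). (c, d, a, b)) ` set (equations D) \<longleftrightarrow>
      (c, d, a, b) \<in> set (equations D)"
    by (force simp: image_iff)
  then show ?thesis by (simp add: relators_def image_iff) blast
qed

lemma relators_sym: "(a, b, c, d) \<in> set (relators D) \<Longrightarrow> (c, d, a, b) \<in> set (relators D)"
  unfolding relators_iff by blast

lemma next_nth: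
  assumes "i < length (alphabet D)"
  shows "next_letter D (alphabet D ! i) = alphabet D ! (Suc i mod length (alphabet D))"
proof -
  have "map_of (zip (alphabet D) (rotate1 (alphabet D))) (alphabet D ! i) =
      Some (rotate1 (alphabet D) ! i)"
    using assms distinct_alphabet by (intro map_of_zip_nth) auto
  with assms show ?thesis by (simp add: next_letter_def nth_rotate1)
qed

lemma prev_nth:
  assumes "i < length (alphabet D)"
  shows "prev_letter D (alphabet D ! (Suc i mod length (alphabet D))) = alphabet D ! i"
proof -
  have "map_of (zip (rotate1 (alphabet D)) (alphabet D)) (rotate1 (alphabet D) ! i) =
      Some (alphabet D ! i)"
    using assms distinct_alphabet by (intro map_of_zip_nth) auto
  with assms show ?thesis by (simp add: prev_letter_def nth_rotate1)
qed

lemma next_alphabet: "a \<in> set (alphabet D) \<Longrightarrow> next_letter D a \<in> set (alphabet D)"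
  by (metis in_set_conv_nth length_pos_if_in_set mod_less_divisor next_nth)

lemma prev_next: "a \<in> set (alphabet D) \<Longrightarrow> prev_letter D (next_letter D a) = a"
  by (metis in_set_conv_nth next_nth prev_nth)

lemma alphabet_induct:
  assumes "a \<in> set (alphabet D)" "P a" "b \<in> set (alphabet D)"
    and step: "\<And>a. a \<in> set (alphabet D) \<Longrightarrow> P a \<Longrightarrow> P (next_letter D a)"
  shows "P b"
proof -
  let ?A = "alphabet D" and ?m = "length (alphabet D)"
  obtain i j where i: "i < ?m" "a = ?A ! i" and j: "j < ?m" "b = ?A ! j"
    using assms(1,3) by (auto simp: in_set_conv_nth)
  have "P (?A ! ((i + k) mod ?m))" for k
  proof (induction k)
    case 0
    then show ?case using i assms(2) by simp
  next
    case (Suc k)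
    have "(i + k) mod ?m < ?m" using i by (intro mod_less_divisor) auto
    then show ?case using step[OF nth_mem Suc] next_nth[of "(i + k) mod ?m" D]
      by (simp add: mod_Suc_eq)
  qed
  \<comment> \<open>From position \<open>i\<close>, this many steps reach \<open>j + ?m\<close>,
    which is \<open>j\<close> on the circle.\<close>
  from this[of "j + (?m - i)"] show ?thesis using i j by simp
qed

lemma next_prev:
  assumes "a \<in> set (alphabet D)"
  shows "prev_letter D a \<in> set (alphabet D)" "next_letter D (prev_letter D a) = a"
proof -
  \<comment> \<open>The property is carried round the circle from the successor of \<open>a\<close>,
    where \<open>prev_next\<close> gives it, back to \<open>a\<close>.\<close>
  have "prev_letter D a \<in> set (alphabet D) \<and> next_letter D (prev_letter D a) = a"
    by (rule alphabet_induct[where a = "next_letter D a" and D = D])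
      (use assms in \<open>auto simp: next_alphabet prev_next\<close>)
  then show "prev_letter D a \<in> set (alphabet D)" "next_letter D (prev_letter D a) = a" by auto
qed


section \<open>Constraints and query\<close>

lemma sat_Exs:
  "sat F v (Exs xs \<phi>) \<longleftrightarrow>
     (\<exists>w. (\<forall>x. x \<notin> set xs \<longrightarrow> w x = v x) \<and> (\<forall>x\<in>set xs. w x \<in> elems F) \<and> sat F w \<phi>)"
proof (induction xs arbitrary: v)
  case Nil
  have "w = v" if "\<forall>x. w x = v x" for w using that by blast
  then show ?case by (auto simp: Exs_def)
next
  case (Cons y ys)
  have "sat F v (Exs (y # ys) \<phi>) \<longleftrightarrow> (\<exists>a\<in>elems F. sat F (v(y := a)) (Exs ys \<phi>))"
    by (simp add: Exs_def)
  also have "\<dots> \<longleftrightarrow> (\<exists>a\<in>elems F. \<exists>w. (\<forall>x. x \<notin> set ys \<longrightarrow> w x = (v(y := a)) x) \<and>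
      (\<forall>x\<in>set ys. w x \<in> elems F) \<and> sat F w \<phi>)"
    using Cons by simp
  also have "\<dots> \<longleftrightarrow> (\<exists>w. (\<forall>x. x \<notin> set (y # ys) \<longrightarrow> w x = v x) \<and>
      (\<forall>x\<in>set (y # ys). w x \<in> elems F) \<and> sat F w \<phi>)" (is "?l \<longleftrightarrow> ?r")
  proof
    assume ?l
    then obtain a w where "a \<in> elems F" "\<forall>x. x \<notin> set ys \<longrightarrow> w x = (v(y := a)) x"
      "\<forall>x\<in>set ys. w x \<in> elems F" "sat F w \<phi>" by blast
    then show ?r by (intro exI[of _ w]) (auto split: if_splits)
  next
    assume ?r
    then obtain w where "\<forall>x. x \<notin> set (y # ys) \<longrightarrow> w x = v x"
      "\<forall>x\<in>set (y # ys). w x \<in> elems F" "sat F w \<phi>" by blast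
    then show ?l by (intro bexI[of _ "w y"] exI[of _ w]) auto
  qed
  finally show ?case .
qed

lemma sat_Alls: "sat F v (Alls xs \<phi>) \<longleftrightarrow> \<not> sat F v (Exs xs (Neg \<phi>))"
  by (induction xs arbitrary: v) (simp_all add: Alls_def Exs_def)

lemma fv_Exs [simp]: "fv (Exs xs \<phi>) = fv \<phi> - set xs"
  by (induction xs) (auto simp: Exs_def)

lemma fv_Alls [simp]: "fv (Alls xs \<phi>) = fv \<phi> - set xs"
  by (induction xs) (auto simp: Alls_def)

lemma fm_over_Exs [simp]: "fm_over \<sigma> (Exs xs \<phi>) \<longleftrightarrow> fm_over \<sigma> \<phi>"
  by (induction xs) (auto simp: Exs_def)

lemma fm_over_Alls [simp]: "fm_over \<sigma> (Alls xs \<phi>) \<longleftrightarrow> fm_over \<sigma> \<phi>"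
  by (induction xs) (auto simp: Alls_def)

lemma elemsI: "(R, us) \<in> F \<Longrightarrow> u \<in> set us \<Longrightarrow> u \<in> elems F"
  by (force simp: elems_def)

lemma satisfies_Alls:
  "satisfies F (Alls xs \<phi>) \<longleftrightarrow> (\<forall>w. (\<forall>x\<in>set xs. w x \<in> elems F) \<longrightarrow> sat F w \<phi>)"
  unfolding satisfies_def sat_Alls sat_Exs by auto

text \<open>The relativisation of the quantifiers disappears because every quantified variable
  occurs in an atom, so its value is an element anyway.\<close>

lemma satisfies_inclusion:
  assumes "set ys \<subseteq> set zs"
  shows "satisfies F (Alls xs (Imp (Atom R xs) (Exs ys (Atom T zs)))) \<longleftrightarrow>
    (\<forall>w. (R, map w xs) \<in> F \<longrightarrow>
      (\<exists>w'. (\<forall>x. x \<notin> set ys \<longrightarrow> w' x = w x) \<and> (T, map w' zs) \<in> F))"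
proof -
  have xs: "\<forall>x\<in>set xs. w x \<in> elems F" if "(R, map w xs) \<in> F" for w
    using elemsI[OF that] by simp
  have ys: "\<forall>x\<in>set ys. w x \<in> elems F" if "(T, map w zs) \<in> F" for w
    using elemsI[OF that] assms by auto
  have "satisfies F (Alls xs (Imp (Atom R xs) (Exs ys (Atom T zs)))) \<longleftrightarrow>
      (\<forall>w. (R, map w xs) \<in> F \<longrightarrow> sat F w (Exs ys (Atom T zs)))"
    unfolding satisfies_Alls sat.simps using xs by blast
  moreover have "sat F w (Exs ys (Atom T zs)) \<longleftrightarrow>
      (\<exists>w'. (\<forall>x. x \<notin> set ys \<longrightarrow> w' x = w x) \<and> (T, map w' zs) \<in> F)" for w
    unfolding sat_Exs sat.simps using ys by blast
  ultimately show ?thesis by simp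
qed

lemma satisfies_Neg_Exs:
  "satisfies F (Neg (Exs xs \<phi>)) \<longleftrightarrow> (\<forall>w. (\<forall>x\<in>set xs. w x \<in> elems F) \<longrightarrow> \<not> sat F w \<phi>)"
  unfolding satisfies_def sat.simps sat_Exs by auto

text \<open>A fact \<open>(0, [v, a, x, b, z])\<close> is a \<open>b\<close>-edge from \<open>x\<close> to \<open>z\<close>, where \<open>v\<close> stands for the letter
  \<open>Link\<close> and \<open>a\<close> for the letter before \<open>b\<close>. A fact \<open>(1, [a, b, c, d])\<close> is the equation
  \<open>ab = cd\<close>. Since letters are elements, too, the successor function on letters can itself be
  given by edges, labelled by \<open>Link\<close>.\<close>

definition edge_dep :: "nat list \<Rightarrow> fm" where
  "edge_dep zs = Alls [0, 1, 2, 3, 4] (Imp (Atom 0 [0, 1, 2, 3, 4]) (Exs [5, 6] (Atom 0 zs)))"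

text \<open>The first two ask, at the source and at the target of an edge, for an edge whose label
  comes after \<open>b\<close>. That label is a fresh variable; the third dependency pins it down by
  a \<open>Link\<close>-edge from the preceding letter.\<close>

definition constraints :: "fm set" where
  "constraints = {edge_dep [0, 3, 2, 5, 6], edge_dep [0, 3, 4, 5, 6], edge_dep [5, 6, 1, 0, 3]}"

text \<open>Variables 0 to 8 are x, a, y, b, z, c, y', d, z'; the others fill the first two
  positions of the edges.\<close>

definition query :: fm where
  "query = Exs [0, 1, 2, 3, 4, 5, 6, 7, 8, 9, 10, 11, 12, 13, 14, 15, 16]
     (And (Atom 1 [1, 3, 5, 7])
     (And (Atom 0 [9, 10, 0, 1, 2])
     (And (Atom 0 [11, 12, 2, 3, 4])
     (And (Atom 0 [13, 14, 0, 5, 6])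
     (And (Atom 0 [15, 16, 6, 7, 8])
       (Atom 2 [4, 8]))))))"

definition base_sig :: signature where "base_sig = [0 \<mapsto> 5, 1 \<mapsto> 4]"
definition order_sig :: signature where "order_sig = [2 \<mapsto> 2]"

lemmas sig_defs = base_sig_def order_sig_def

lemma constraints_inclusion: "\<phi> \<in> constraints \<Longrightarrow> inclusion_dependency_over base_sig \<phi>"
proof -
  have "inclusion_dependency_over base_sig (edge_dep zs)"
    if "distinct zs" "{5, 6} \<subseteq> set zs" "set zs \<subseteq> {0, 1, 2, 3, 4, 5, 6}" "length zs = 5" for zs
  proof -
    have "sentence_over base_sig (edge_dep zs)"
      using that by (auto simp: sentence_over_def edge_dep_def sig_defs)
    then show ?thesis unfolding inclusion_dependency_over_def
    proof
      show "\<exists>R T xs ys zs'. edge_dep zs = Alls xs (Imp (Atom R xs) (Exs ys (Atom T zs'))) \<and>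
          distinct xs \<and> distinct ys \<and> distinct zs' \<and> set xs \<inter> set ys = {} \<and>
          set ys \<subseteq> set zs' \<and> set zs' \<subseteq> set xs \<union> set ys"
        by (rule exI[of _ 0], rule exI[of _ 0], rule exI[of _ "[0, 1, 2, 3, 4]"],
            rule exI[of _ "[5, 6]"], rule exI[of _ zs]) (use that in \<open>auto simp: edge_dep_def\<close>)
    qed
  qed
  then show "\<phi> \<in> constraints \<Longrightarrow> inclusion_dependency_over base_sig \<phi>"
    unfolding constraints_def by auto
qed

lemma cq_query: "cq_over (base_sig ++ order_sig) query"
proof -
  have "sentence_over (base_sig ++ order_sig) query"
    by (simp add: sentence_over_def query_def sig_defs)
  moreover have "\<exists>xs \<psi>. query = Exs xs \<psi> \<and> conj_of_atoms \<psi>"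
    unfolding query_def by (intro exI conjI, rule refl) simp
  ultimately show ?thesis unfolding cq_over_def by blast
qed

lemma satisfies_edge_dep:
  assumes "{5, 6} \<subseteq> set zs" "set zs \<subseteq> {0, 1, 2, 3, 4, 5, 6}"
  shows "satisfies F (edge_dep zs) \<longleftrightarrow>
    (\<forall>v a x b z. (0, [v, a, x, b, z]) \<in> F \<longrightarrow>
      (\<exists>c d. (0, map (nth [v, a, x, b, z, c, d]) zs) \<in> F))"
proof -
  have map_eq: "map w zs = map (nth [w 0, w 1, w 2, w 3, w 4, w 5, w 6]) zs" for w :: "nat \<Rightarrow> 'a"
    using assms(2) by (intro map_cong) auto
  have "satisfies F (edge_dep zs) \<longleftrightarrow> (\<forall>w. (0, map w [0, 1, 2, 3, 4]) \<in> F \<longrightarrow>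
      (\<exists>w'. (\<forall>x. x \<notin> set [5, 6] \<longrightarrow> w' x = w x) \<and> (0, map w' zs) \<in> F))"
    unfolding edge_dep_def using assms(1) by (intro satisfies_inclusion) simp
  also have "\<dots> \<longleftrightarrow> (\<forall>v a x b z. (0, [v, a, x, b, z]) \<in> F \<longrightarrow>
      (\<exists>c d. (0, map (nth [v, a, x, b, z, c, d]) zs) \<in> F))" (is "?l \<longleftrightarrow> ?r")
  proof
    assume l: ?l
    show ?r
    proof (intro allI impI)
      fix v a x b z assume "(0, [v, a, x, b, z]) \<in> F"
      then have "(0, map (nth [v, a, x, b, z]) [0, 1, 2, 3, 4]) \<in> F" by simp
      then obtain w' where w': "\<And>i. i \<notin> set [5, 6] \<Longrightarrow> w' i = [v, a, x, b, z] ! i"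
        and "(0, map w' zs) \<in> F"
        using l by blast
      moreover have "w' 0 = v" "w' 1 = a" "w' 2 = x" "w' 3 = b" "w' 4 = z"
        by (simp_all add: w')
      ultimately show "\<exists>c d. (0, map (nth [v, a, x, b, z, c, d]) zs) \<in> F"
        using map_eq[of w'] by metis
    qed
  next
    assume r: ?r
    show ?l
    proof (intro allI impI)
      fix w :: "nat \<Rightarrow> 'a" assume "(0, map w [0, 1, 2, 3, 4]) \<in> F"
      then obtain c d where "(0, map (nth [w 0, w 1, w 2, w 3, w 4, c, d]) zs) \<in> F"
        using r unfolding list.map by blast
      moreover have "map (w(5 := c, 6 := d)) zs = map (nth [w 0, w 1, w 2, w 3, w 4, c, d]) zs"
        by (subst map_eq) simp
      ultimately show "\<exists>w'. (\<forall>x. x \<notin> set [5, 6] \<longrightarrow> w' x = w x) \<and> (0, map w' zs) \<in> F"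
        by (intro exI[of _ "w(5 := c, 6 := d)"]) (simp del: map_eq_conv)
    qed
  qed
  finally show ?thesis .
qed

lemma satisfies_constraints:
  "(\<forall>\<phi>\<in>constraints. satisfies F \<phi>) \<longleftrightarrow>
    (\<forall>v a x b z. (0, [v, a, x, b, z]) \<in> F \<longrightarrow>
      (\<exists>c d. (0, [v, b, x, c, d]) \<in> F) \<and> (\<exists>c d. (0, [v, b, z, c, d]) \<in> F) \<and>
      (\<exists>c d. (0, [c, d, a, v, b]) \<in> F))"
  unfolding constraints_def by (simp add: satisfies_edge_dep) blast

lemma satisfies_Neg_query:
  "satisfies F (Neg query) \<longleftrightarrow>
    (\<forall>a b c d x y z y' z' u1 v1 u2 v2 u3 v3 u4 v4. (1, [a, b, c, d]) \<in> F \<longrightarrow>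
      (0, [u1, v1, x, a, y]) \<in> F \<longrightarrow> (0, [u2, v2, y, b, z]) \<in> F \<longrightarrow>
      (0, [u3, v3, x, c, y']) \<in> F \<longrightarrow> (0, [u4, v4, y', d, z']) \<in> F \<longrightarrow> (2, [z, z']) \<notin> F)"
  (is "_ \<longleftrightarrow> ?r")
proof
  assume l: "satisfies F (Neg query)"
  show ?r
  proof (intro allI impI notI)
    fix a b c d x y z y' z' u1 v1 u2 v2 u3 v3 u4 v4
    assume F: "(1, [a, b, c, d]) \<in> F" "(0, [u1, v1, x, a, y]) \<in> F" "(0, [u2, v2, y, b, z]) \<in> F"
      "(0, [u3, v3, x, c, y']) \<in> F" "(0, [u4, v4, y', d, z']) \<in> F" "(2, [z, z']) \<in> F"
    define w where "w = nth [x, a, y, b, z, c, y', d, z', u1, v1, u2, v2, u3, v3, u4, v4]"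
    have w: "w 0 = x" "w 1 = a" "w 2 = y" "w 3 = b" "w 4 = z" "w 5 = c" "w 6 = y'" "w 7 = d"
      "w 8 = z'" "w 9 = u1" "w 10 = v1" "w 11 = u2" "w 12 = v2" "w 13 = u3" "w 14 = v3"
      "w 15 = u4" "w 16 = v4"
      by (simp_all add: w_def)
    have "{x, a, y, b, z, c, y', d, z', u1, v1, u2, v2, u3, v3, u4, v4} \<subseteq> elems F"
      using F by (auto intro: elemsI)
    then have "\<forall>i\<in>set [0, 1, 2, 3, 4, 5, 6, 7, 8, 9, 10, 11, 12, 13, 14, 15, 16]. w i \<in> elems F"
      using w by simp
    moreover have "sat F w (And (Atom 1 [1, 3, 5, 7])
       (And (Atom 0 [9, 10, 0, 1, 2]) (And (Atom 0 [11, 12, 2, 3, 4])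
       (And (Atom 0 [13, 14, 0, 5, 6]) (And (Atom 0 [15, 16, 6, 7, 8]) (Atom 2 [4, 8]))))))"
      using F w by simp
    ultimately show False
      using l unfolding query_def satisfies_Neg_Exs by blast
  qed
next
  assume r: ?r
  show "satisfies F (Neg query)"
    unfolding query_def satisfies_Neg_Exs
  proof (intro allI impI notI)
    fix w assume "sat F w (And (Atom 1 [1, 3, 5, 7])
       (And (Atom 0 [9, 10, 0, 1, 2]) (And (Atom 0 [11, 12, 2, 3, 4])
       (And (Atom 0 [13, 14, 0, 5, 6]) (And (Atom 0 [15, 16, 6, 7, 8]) (Atom 2 [4, 8]))))))"
    then show False
      unfolding sat.simps list.map using r by blast
  qed
qed


section \<open>Input instances\<close>

datatype node = Stack "nat list" | Letter letter | Bot

instance node :: countable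
  by countable_datatype

definition edge :: "prog \<Rightarrow> node \<Rightarrow> letter \<Rightarrow> node \<Rightarrow> node fact" where
  "edge D u a w = (0, [Letter Link, Letter (prev_letter D a), u, Letter a, w])"

fun relator_fact :: "letter \<times> letter \<times> letter \<times> letter \<Rightarrow> node fact" where
  "relator_fact (a, b, c, d) = (1, [Letter a, Letter b, Letter c, Letter d])"

text \<open>The \<open>Nop\<close>-loops at 0 and 1 turn equality up to powers of \<open>Nop\<close>
  into equality of these two nodes; the one at the empty stack supplies an incoming edge
  there.\<close>

definition base :: "prog \<Rightarrow> node fact list" where
  "base D = map relator_fact (relators D)
     @ map (\<lambda>a. edge D (Letter a) Link (Letter (next_letter D a))) (alphabet D)
     @ [edge D (Stack []) (Code Nop) (Stack []), edge D (Stack []) (Code Push) (Stack [0]),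
        edge D (Stack [0]) (Code Nop) (Stack [0]), edge D (Stack [1]) (Code Nop) (Stack [1])]"

text \<open>The number \<open>n\<close> is spelled in unary, last edge first, since primitive
  recursion prepends the edges one by one. The \<open>Main\<close>-edge is the claim that
  \<open>D\<close> outputs 1 on \<open>n\<close>.\<close>

definition input :: "prog \<Rightarrow> nat \<Rightarrow> node fact list" where
  "input D n = edge D (Stack [n]) Main (Stack [1])
     # rev (map (\<lambda>i. edge D (Stack [i]) (Code Incr) (Stack [Suc i])) [0..<n]) @ base D"

definition map_facts :: "('a \<Rightarrow> 'b) \<Rightarrow> 'a fact set \<Rightarrow> 'b fact set" where
  "map_facts g F = (\<lambda>(R, us). (R, map g us)) ` F"

lemma map_facts_mono: "F \<subseteq> G \<Longrightarrow> map_facts g F \<subseteq> map_facts g G"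
  unfolding map_facts_def by blast

lemma map_factsI: "(R, us) \<in> F \<Longrightarrow> (R, map g us) \<in> map_facts g F"
  unfolding map_facts_def by force

lemma basic_alphabet [simp]:
  "Link \<in> set (alphabet D)" "Main \<in> set (alphabet D)" "Code Nop \<in> set (alphabet D)"
  "Code Push \<in> set (alphabet D)" "Code Incr \<in> set (alphabet D)"
  using basic_letters_alphabet[of D] by (auto simp: basic_letters_def)

lemma prev_basic [simp]:
  "prev_letter D (Code Incr) = Code Push" "prev_letter D Main = Code Incr"
  by (simp_all add: prev_letter_def alphabet_def basic_letters_def)

lemma input_over:
  assumes "(R, us) \<in> set (input D n)" shows "(base_sig ++ order_sig) R = Some (length us)"
  using assms by (auto simp: input_def base_def edge_def sig_defs)


subsection \<open>The value 0 forces the query\<close>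

locale counterexample =
  fixes D :: prog and n :: nat and g :: "node \<Rightarrow> 'a" and F :: "'a fact set"
  assumes inj: "inj g"
    and input: "map_facts g (set (input D n)) \<subseteq> F"
    and constraints: "\<forall>\<phi>\<in>constraints. satisfies F \<phi>"
    and query: "satisfies F (Neg query)"
    and order: "strict_linear_order_on (elems F) (rel_of F 2)"
begin

abbreviation el :: "letter \<Rightarrow> 'a" where "el a \<equiv> g (Letter a)"

abbreviation A :: "letter set" where "A \<equiv> set (alphabet D)"

lemma sibling: "(0, [v, a, x, b, z]) \<in> F \<Longrightarrow> \<exists>c d. (0, [v, b, x, c, d]) \<in> F"
  and child: "(0, [v, a, x, b, z]) \<in> F \<Longrightarrow> \<exists>c d. (0, [v, b, z, c, d]) \<in> F"
  and link: "(0, [v, a, x, b, z]) \<in> F \<Longrightarrow> \<exists>c d. (0, [c, d, a, v, b]) \<in> F"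
  using constraints unfolding satisfies_constraints by blast+

text \<open>The equation excludes \<open>z < z'\<close>, its mirror image excludes
  \<open>z' < z\<close>, and totality of the order leaves equality.\<close>

lemma equate:
  assumes "(a, b, c, d) \<in> set (relators D)"
    and F: "(0, [u1, v1, x, el a, y]) \<in> F" "(0, [u2, v2, y, el b, z]) \<in> F"
      "(0, [u3, v3, x, el c, y']) \<in> F" "(0, [u4, v4, y', el d, z']) \<in> F"
  shows "z = z'"
proof -
  have rel: "(1, [el a, el b, el c, el d]) \<in> F" if "(a, b, c, d) \<in> set (relators D)" for a b c d
  proof -
    have "(1, [Letter a, Letter b, Letter c, Letter d]) \<in> set (input D n)"
      using that by (force simp: input_def base_def image_iff)
    from map_factsI[OF this, of g] show ?thesis using input by auto
  qed
  have "(2, [z, z']) \<notin> F"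
    using query rel[OF assms(1)] F unfolding satisfies_Neg_query by blast
  moreover have "(2, [z', z]) \<notin> F"
    using query rel[OF relators_sym[OF assms(1)]] F unfolding satisfies_Neg_query by blast
  moreover have "z \<in> elems F" "z' \<in> elems F"
    using elemsI[OF F(2)] elemsI[OF F(4)] by auto
  ultimately show ?thesis
    using order unfolding strict_linear_order_on_def total_on_def rel_of_def by auto
qed

section \<open>The action given by the edges of a counterexample\<close>

definition edg :: "'a \<Rightarrow> letter \<Rightarrow> 'a \<Rightarrow> bool" where
  "edg x a y \<longleftrightarrow> (\<exists>u v. (0, [u, v, x, el a, y]) \<in> F)"

lemma edg_relator:
  "(a, b, c, d) \<in> set (relators D) \<Longrightarrow> edg x a y \<Longrightarrow> edg y b z \<Longrightarrow> edg x c y' \<Longrightarrow> edg y' d z' \<Longrightarrow>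
    z = z'"
  unfolding edg_def using equate by blast

lemma input_edge:
  "edge D u a w \<in> set (input D n) \<Longrightarrow>
    (0, [el Link, el (prev_letter D a), g u, el a, g w]) \<in> F"
  using input map_factsI[of 0 _ _ g] unfolding edge_def by fastforce

lemma input_edg: "edge D u a w \<in> set (input D n) \<Longrightarrow> edg (g u) a (g w)"
  using input_edge unfolding edg_def by blast

lemma link_edg: "a \<in> A \<Longrightarrow> edg (el a) Link (el (next_letter D a))"
  by (rule input_edg) (simp add: input_def base_def)

text \<open>The \<open>Link\<close>-edge leaving \<open>el a\<close> is unique: \<open>el a\<close>
  is entered by \<open>Link\<close> from the preceding letter, so the equation
  \<open>Link Link = Link Link\<close> applies.\<close>

lemma next_label:
  assumes "a \<in> A" "(0, [el Link, el a, x, b, z]) \<in> F" shows "b = el (next_letter D a)"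
proof -
  have "edg (el a) Link b" using link[OF assms(2)] unfolding edg_def by blast
  moreover have "edg (el (prev_letter D a)) Link (el a)"
    using link_edg next_prev assms(1) by metis
  moreover have "(Link, Link, Link, Link) \<in> set (relators D)" by (simp add: relators_iff)
  ultimately show ?thesis using edg_relator link_edg[OF assms(1)] by blast
qed

text \<open>The equations \<open>ba = ba\<close> make edges functional, but only at nodes that have an incoming
  edge.\<close>

definition good :: "'a \<Rightarrow> bool" where
  "good x \<longleftrightarrow> (\<exists>a\<in>A. \<exists>b z. (0, [el Link, el a, x, b, z]) \<in> F) \<and> (\<exists>w. \<exists>b\<in>A. edg w b x)"

text \<open>\<open>sibling\<close> walks round the alphabet to the letter before \<open>a\<close>,
  which yields the \<open>a\<close>-edge; \<open>child\<close> then provides an outgoing edge at its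
  target.\<close>

lemma good_edg:
  assumes "good x" "a \<in> A" shows "\<exists>y. edg x a y \<and> good y"
proof -
  obtain a' where a': "a' \<in> A" "\<exists>b z. (0, [el Link, el a', x, b, z]) \<in> F"
    using assms(1) unfolding good_def by blast
  have "\<exists>b z. (0, [el Link, el (prev_letter D a), x, b, z]) \<in> F"
  proof (rule alphabet_induct[where P = "\<lambda>c. \<exists>b z. (0, [el Link, el c, x, b, z]) \<in> F", OF a'])
    show "prev_letter D a \<in> A" using next_prev assms(2) by blast
  next
    fix c assume "c \<in> A" "\<exists>b z. (0, [el Link, el c, x, b, z]) \<in> F"
    then show "\<exists>b z. (0, [el Link, el (next_letter D c), x, b, z]) \<in> F"
      using sibling next_label by blast
  qed
  then obtain z where z: "(0, [el Link, el (prev_letter D a), x, el a, z]) \<in> F"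
    using next_label next_prev assms(2) by metis
  with child[OF z] assms(2) show ?thesis unfolding good_def edg_def by blast
qed

lemma edg_functional:
  assumes "good x" "a \<in> A" "edg x a y" "edg x a z" shows "y = z"
proof -
  obtain w b where "b \<in> A" "edg w b x" using assms(1) unfolding good_def by blast
  moreover from this have "(b, a, b, a) \<in> set (relators D)" using assms(2) by (simp add: relators_iff)
  ultimately show ?thesis using edg_relator assms(3,4) by blast
qed

definition act :: "'a \<Rightarrow> letter \<Rightarrow> 'a" where
  "act x a = (THE y. edg x a y)"

lemma act_eq: "good x \<Longrightarrow> a \<in> A \<Longrightarrow> edg x a y \<Longrightarrow> act x a = y"
  unfolding act_def using edg_functional by blast

lemma edg_act: "good x \<Longrightarrow> a \<in> A \<Longrightarrow> edg x a (act x a)"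
  and good_act: "good x \<Longrightarrow> a \<in> A \<Longrightarrow> good (act x a)"
  using good_edg act_eq by metis+

lemma act_relator:
  assumes "good x" "(a, b, c, d) \<in> set (relators D)" "{a, b, c, d} \<subseteq> A"
  shows "act (act x a) b = act (act x c) d"
  using edg_relator[OF assms(2)] edg_act good_act assms by (meson insert_subset)

sublocale stack_action "Collect good" A "set (equations D)" act
proof
  fix x a b c d assume "x \<in> Collect good" "(a, b, c, d) \<in> set (equations D)"
  then show "act (act x a) b = act (act x c) d"
    using act_relator equations_alphabet by (simp add: relators_iff)
next
  fix x a assume "x \<in> Collect good" "a \<in> A"
  then show "act (act x a) (Code Nop) = act (act x (Code Nop)) a"
    by (intro act_relator) (simp_all add: relators_iff)
qed (use good_act equations_alphabet in auto)

lemma good_loop: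
  assumes "edge D u (Code Nop) u \<in> set (input D n)"
  shows "good (g u)" "(nop ^^ i) (g u) = g u"
proof -
  show good: "good (g u)"
    unfolding good_def using input_edge[OF assms] input_edg[OF assms] next_prev(1)[of "Code Nop" D]
    by (metis basic_alphabet(3))
  show "(nop ^^ i) (g u) = g u"
    by (induction i) (use act_eq[OF good _ input_edg[OF assms]] in auto)
qed

lemma value_not_0: "\<not> run D [n] [0]"
proof
  assume run: "run D [n] [0]"
  let ?r = "g (Stack [])"
  have loops: "edge D (Stack s) (Code Nop) (Stack s) \<in> set (input D n)" if "s \<in> {[], [0], [1]}" for s
    using that by (auto simp: input_def base_def)
  have r: "good ?r" using good_loop loops by simp
  have stack: "stack ?r [i] = g (Stack [i])" if "i \<le> n" for i
    using that
  proof (induction i)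
    case 0
    have "edge D (Stack []) (Code Push) (Stack [0]) \<in> set (input D n)"
      by (simp add: input_def base_def)
    from act_eq[OF r _ input_edg[OF this]] show ?case by simp
  next
    case (Suc i)
    then have IH: "stack ?r [i] = g (Stack [i])" by simp
    then have good: "good (g (Stack [i]))" using stack_closed[of ?r "[i]"] r by simp
    have "edge D (Stack [i]) (Code Incr) (Stack [Suc i]) \<in> set (input D n)"
      using Suc.prems by (simp add: input_def)
    from act_eq[OF good _ input_edg[OF this]] IH show ?case by simp
  qed
  have good: "good (g (Stack [n]))" using stack_closed[of ?r "[n]"] stack[of n] r by simp
  have "edge D (Stack [n]) Main (Stack [1]) \<in> set (input D n)" by (simp add: input_def)
  from act_eq[OF good _ input_edg[OF this]] have main: "act (g (Stack [n])) Main = g (Stack [1])"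
    by simp
  have eq: "(Main, Code Nop, Code D, Code Nop) \<in> set (equations D)"
    and rules: "code_rule ` set (rules D) \<subseteq> set (equations D)"
    by (auto simp: equations_def)
  then have D: "Code D \<in> A" using equations_alphabet by blast
  \<comment> \<open>The input leads from \<open>n\<close> to 1 by \<open>Main\<close>, the first
    equation replaces \<open>Main\<close> by \<open>D\<close>, and the run of \<open>D\<close> leads
    to 0.\<close>
  have "sim (g (Stack [1])) (nop (act (g (Stack [n])) (Code D)))"
    using sim_rule_nop_left[OF _ eq, of "g (Stack [n])"] good main by simp
  also have "sim \<dots> (act (g (Stack [n])) (Code D))"
    using sim_nop good_act[OF good D] by simp
  also have "sim \<dots> (g (Stack [0]))"
    using sim_run[OF _ run rules, of ?r] r stack by (simp del: stack.simps)
  finally obtain i j where "(nop ^^ i) (g (Stack [1])) = (nop ^^ j) (g (Stack [0]))"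
    unfolding sim_def by blast
  then show False using good_loop(2)[OF loops] inj by (simp add: inj_eq)
qed

end


subsection \<open>The value 1 gives a counterexample\<close>

text \<open>Undefinedness becomes the absorbing node \<open>Bot\<close>, which makes the action
  total.\<close>

fun exec :: "prog \<Rightarrow> node \<Rightarrow> node" where
  "exec p (Stack s) = (if \<exists>t. run p s t then Stack (THE t. run p s t) else Bot)"
| "exec p _ = Bot"

fun move :: "prog \<Rightarrow> letter \<Rightarrow> node \<Rightarrow> node" where
  "move D (Code p) u = exec p u"
| "move D Main u = exec D u"
| "move D Link (Letter a) = Letter (next_letter D a)"
| "move D Link _ = Bot"

lemma exec_eq_Stack_iff: "exec p (Stack s) = Stack t \<longleftrightarrow> run p s t"
proof -
  have "(THE t'. run p s t') = t'" if "run p s t'" for t'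
    using that run_functional by blast
  then show ?thesis by auto
qed

lemma exec_not_Letter: "exec p u \<noteq> Letter a"
  by (cases u) auto

lemma exec_run: "run p s t \<Longrightarrow> exec p (Stack s) = Stack t"
  using exec_eq_Stack_iff by blast

declare exec.simps(1) [simp del]

lemma exec_Nop: "exec Nop (Stack s) = Stack s"
  by (simp add: exec_run)

lemma exec_exec_eq_Stack_iff:
  "exec q (exec p (Stack s)) = Stack u \<longleftrightarrow> (\<exists>t. run p s t \<and> run q t u)"
proof (cases "exec p (Stack s)")
  case (Stack t)
  then have "run p s t" by (simp add: exec_eq_Stack_iff)
  then show ?thesis unfolding Stack exec_eq_Stack_iff using run_functional by blast
next
  case Bot
  then have "\<not> run p s t" for t using exec_run by fastforce
  then show ?thesis using Bot by simp
qed (simp add: exec_not_Letter)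

text \<open>Results of \<open>exec\<close> are stacks or \<open>Bot\<close>, so it suffices that
  both sides reach the same stacks, which is \<open>rules_sound\<close>.\<close>

lemma move_rule:
  assumes "(a, b, c, d) \<in> set (rules p)"
  shows "exec b (exec a u) = exec d (exec c u)"
proof (cases u)
  case (Stack s)
  have eq: "exec b (exec a u) = Stack t \<longleftrightarrow> exec d (exec c u) = Stack t" for t
    unfolding Stack exec_exec_eq_Stack_iff using rules_sound[OF assms] .
  show ?thesis
  proof (cases "exec b (exec a u)")
    case (Stack t)
    then show ?thesis using eq by simp
  next
    case Bot
    then show ?thesis using eq exec_not_Letter[of d "exec c u"] by (cases "exec d (exec c u)") auto
  qed (simp add: exec_not_Letter)
qed simp_all

lemma move_equation:
  assumes "(a, b, c, d) \<in> set (equations D)"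
  shows "move D b (move D a u) = move D d (move D c u)"
proof -
  have "\<exists>a' b' c' d'. (a, b, c, d) = code_rule (a', b', c', d') \<and> (a', b', c', d') \<in> set (rules D) \<or>
      (a, b, c, d) = (Main, Code Nop, Code D, Code Nop)"
    using assms by (auto simp: equations_def)
  then show ?thesis using move_rule by auto
qed

text \<open>\<open>Nop\<close> fixes stacks and \<open>Bot\<close>. On a letter node both orders end
  in \<open>Bot\<close>, even for \<open>Link\<close>, because \<open>Nop\<close> sends letter nodes
  there.\<close>

lemma move_Nop_commute:
  "move D (Code Nop) (move D a u) = move D a (move D (Code Nop) u)"
proof -
  have "exec Nop (exec p u) = exec p (exec Nop u)" for p
  proof (cases u)
    case (Stack s)
    then show ?thesis using exec_not_Letter[of p u] exec_Nop by (cases "exec p u") auto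
  qed simp_all
  moreover have "exec Nop (move D Link u) = move D Link (exec Nop u)"
    by (cases u) (simp_all add: exec_Nop)
  ultimately show ?thesis by (cases a) auto
qed

lemma move_relator:
  assumes "(a, b, c, d) \<in> set (relators D)"
  shows "move D b (move D a u) = move D d (move D c u)"
  using assms move_equation move_Nop_commute unfolding relators_iff by metis

text \<open>Any strict linear order would do, as the two paths in the query always end in the same
  node; countability of \<open>node\<close> supplies one.\<close>

definition model :: "prog \<Rightarrow> node fact set" where
  "model D =
     {(0, [Letter Link, Letter a, u, Letter b, move D b u]) |a b u.
        a \<in> set (alphabet D) \<and> b = next_letter D a}
     \<union> set (map relator_fact (relators D))
     \<union> {(2, [u, v]) |u v. to_nat u < to_nat v}"

lemma edge_model:
  assumes "a \<in> set (alphabet D)" "w = move D a u"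
  shows "edge D u a w \<in> model D"
  using next_prev[OF assms(1)] assms(2) unfolding model_def edge_def by simp

lemma input_model:
  assumes "run D [n] [1]" shows "set (input D n) \<subseteq> model D"
proof -
  have "set (map relator_fact (relators D)) \<subseteq> model D" unfolding model_def by blast
  moreover have "edge D (Letter a) Link (Letter (next_letter D a)) \<in> model D" for a
    by (rule edge_model) simp_all
  moreover have "edge D (Stack s) (Code Nop) (Stack s) \<in> model D" for s
    by (rule edge_model) (simp_all add: exec_Nop)
  moreover have "edge D (Stack []) (Code Push) (Stack [0]) \<in> model D"
    by (rule edge_model) (simp_all add: exec_run)
  moreover have "edge D (Stack [i]) (Code Incr) (Stack [Suc i]) \<in> model D" for i
    by (rule edge_model) (simp_all add: exec_run)
  moreover have "edge D (Stack [n]) Main (Stack [1]) \<in> model D"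
    by (rule edge_model) (use assms in \<open>simp_all add: exec_run\<close>)
  ultimately show ?thesis unfolding input_def base_def by auto
qed

lemma edge_map_model_iff:
  "(0, [v, a', x, b', z]) \<in> map_facts g (model D) \<longleftrightarrow>
    (\<exists>a b u. a \<in> set (alphabet D) \<and> b = next_letter D a \<and> v = g (Letter Link) \<and>
       a' = g (Letter a) \<and> x = g u \<and> b' = g (Letter b) \<and> z = g (move D b u))"
  unfolding map_facts_def model_def by (auto simp: image_iff) force

lemma map_model_constraints: "\<forall>\<phi>\<in>constraints. satisfies (map_facts g (model D)) \<phi>"
  unfolding satisfies_constraints
proof (intro allI impI)
  fix v a' x b' z assume "(0, [v, a', x, b', z]) \<in> map_facts g (model D)"
  then obtain a b u where f: "a \<in> set (alphabet D)" "b = next_letter D a" "v = g (Letter Link)"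
    "a' = g (Letter a)" "x = g u" "b' = g (Letter b)" "z = g (move D b u)"
    unfolding edge_map_model_iff by blast
  have b: "b \<in> set (alphabet D)" using f next_alphabet by simp
  have "\<exists>c d. (0, [v, b', g w, c, d]) \<in> map_facts g (model D)" for w
    unfolding edge_map_model_iff using b f by blast
  \<comment> \<open>\<open>Link\<close> moves the node \<open>Letter a\<close> to
    \<open>Letter b\<close>, so the required fact is an edge at a letter node.\<close>
  moreover have "(0, [g (Letter Link), g (Letter (prev_letter D Link)), a', v, b'])
      \<in> map_facts g (model D)"
    unfolding edge_map_model_iff using next_prev[of Link D] f
    by (intro exI[of _ "prev_letter D Link"] exI[of _ Link] exI[of _ "Letter a"]) simp
  ultimately show "(\<exists>c d. (0, [v, b', x, c, d]) \<in> map_facts g (model D)) \<and>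
      (\<exists>c d. (0, [v, b', z, c, d]) \<in> map_facts g (model D)) \<and>
      (\<exists>c d. (0, [c, d, a', v, b']) \<in> map_facts g (model D))"
    using f by blast
qed

lemma order_map_model_iff:
  "(2, [x, y]) \<in> map_facts g (model D) \<longleftrightarrow> (\<exists>u v. to_nat u < to_nat v \<and> x = g u \<and> y = g v)"
  unfolding map_facts_def model_def by (auto simp: image_iff) force

lemma map_model_query:
  assumes "inj g" shows "satisfies (map_facts g (model D)) (Neg query)"
  unfolding satisfies_Neg_query
proof (intro allI impI)
  let ?F = "map_facts g (model D)"
  fix a' b' c' d' x y z y' z' u1 v1 u2 v2 u3 v3 u4 v4
  assume rel: "(1, [a', b', c', d']) \<in> ?F"
    and "(0, [u1, v1, x, a', y]) \<in> ?F" "(0, [u2, v2, y, b', z]) \<in> ?F"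
    "(0, [u3, v3, x, c', y']) \<in> ?F" "(0, [u4, v4, y', d', z']) \<in> ?F"
  note edges = this(2-5)
  obtain a b c d where abcd: "(a, b, c, d) \<in> set (relators D)"
    "a' = g (Letter a)" "b' = g (Letter b)" "c' = g (Letter c)" "d' = g (Letter d)"
    using rel unfolding map_facts_def model_def by auto
  have node: "\<exists>u. x = g u"
    using edges(1) unfolding edge_map_model_iff by blast
  have move: "t = g (move D l u)" if "(0, [p, q, g u, g (Letter l), t]) \<in> ?F" for p q u l t
    using that assms unfolding edge_map_model_iff by (auto simp: inj_eq)
  obtain u where u: "x = g u" using node ..
  have y: "y = g (move D a u)" using edges(1) unfolding u abcd by (rule move)
  have z: "z = g (move D b (move D a u))" using edges(2) unfolding y abcd by (rule move)
  have y': "y' = g (move D c u)" using edges(3) unfolding u abcd by (rule move)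
  have z': "z' = g (move D d (move D c u))" using edges(4) unfolding y' abcd by (rule move)
  have "z = z'" unfolding z z' using move_relator[OF abcd(1)] by simp
  then show "(2, [z, z']) \<notin> ?F"
    using assms unfolding order_map_model_iff by (auto simp: inj_eq)
qed

lemma map_model_order:
  assumes "inj g"
  shows "strict_linear_order_on (elems (map_facts g (model D))) (rel_of (map_facts g (model D)) 2)"
proof -
  have "rel_of (map_facts g (model D)) 2 = {(g u, g v) |u v. to_nat u < to_nat v}"
    unfolding rel_of_def order_map_model_iff by blast
  moreover have "elems (map_facts g (model D)) \<subseteq> range g"
    unfolding elems_def map_facts_def by auto
  ultimately show ?thesis
    using assms unfolding strict_linear_order_on_def trans_def irrefl_def total_on_def
    by (auto simp: inj_eq) (metis linorder_neqE_nat rangeE subsetD to_nat_split)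
qed

lemma map_model_over:
  assumes "\<alpha> \<in> map_facts g (model D)" shows "fact_over (base_sig ++ order_sig) \<alpha>"
  using assms unfolding map_facts_def model_def fact_over_def by (auto simp: sig_defs)

lemma QA_lin_value:
  assumes "inj g"
    and "run D [n] [if QA_lin base_sig order_sig (map_facts g (set (input D n))) constraints query
      then 1 else 0]"
  shows False
proof (cases "QA_lin base_sig order_sig (map_facts g (set (input D n))) constraints query")
  case True
  then have "run D [n] [1]" using assms(2) by simp
  then have "map_facts g (set (input D n)) \<subseteq> map_facts g (model D)"
    using input_model map_facts_mono by blast
  moreover have "\<forall>\<alpha>\<in>map_facts g (model D). fact_over (base_sig ++ order_sig) \<alpha>"
    using map_model_over by blast
  moreover have "\<forall>R\<in>dom order_sig. strict_linear_order_on (elems (map_facts g (model D)))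
      (rel_of (map_facts g (model D)) R)"
    using map_model_order[OF assms(1)] by (simp add: order_sig_def)
  ultimately show False
    using True map_model_constraints map_model_query[OF assms(1)] unfolding QA_lin_def by blast
next
  case False
  then have "run D [n] [0]" using assms(2) by simp
  moreover obtain F where "counterexample D n g F"
    using False assms(1) unfolding QA_lin_def counterexample_def by (auto simp: order_sig_def)
  ultimately show False using counterexample.value_not_0 by blast
qed


section \<open>The input is computable\<close>

lemma rec_eval_Comp1: "rec_eval g xs y \<Longrightarrow> rec_eval f [y] z \<Longrightarrow> rec_eval (Comp f [g]) xs z"
  by (rule rec_eval.Comp[of _ _ "[y]"]) auto

lemma rec_eval_Comp2:
  "rec_eval g xs y \<Longrightarrow> rec_eval h xs z \<Longrightarrow> rec_eval f [y, z] u \<Longrightarrow> rec_eval (Comp f [g, h]) xs u"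
  by (rule rec_eval.Comp[of _ _ "[y, z]"]) auto

lemma rec_eval_Proj: "i < length xs \<Longrightarrow> y = xs ! i \<Longrightarrow> rec_eval (Proj i) xs y"
  using rec_eval.Proj by simp

primrec const_rec :: "nat \<Rightarrow> recf" where
  "const_rec 0 = Zero"
| "const_rec (Suc k) = Comp Succ [const_rec k]"

lemma rec_eval_const: "rec_eval (const_rec k) xs k"
  by (induction k) (auto intro: rec_eval.Zero rec_eval.Succ rec_eval_Comp1)

definition "add_rec = Prec (Proj 0) (Comp Succ [Proj 1])"

lemma rec_eval_add: "rec_eval add_rec [m, n] (m + n)"
  unfolding add_rec_def
proof (induction m)
  case 0
  show ?case by (intro rec_eval.Prec_0 rec_eval_Proj) simp_all
next
  case (Suc m)
  have "rec_eval (Comp Succ [Proj 1]) [m, m + n, n] (Suc (m + n))"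
    by (rule rec_eval_Comp1[OF rec_eval_Proj rec_eval.Succ]) simp_all
  with Suc show ?case by (auto intro: rec_eval.Prec_Suc)
qed

definition "triangle_rec = Prec Zero (Comp Succ [Comp add_rec [Proj 0, Proj 1]])"

lemma rec_eval_triangle: "rec_eval triangle_rec [n] (triangle n)"
  unfolding triangle_rec_def
proof (induction n)
  case 0
  show ?case by (auto intro: rec_eval.intros)
next
  case (Suc n)
  have "rec_eval (Comp Succ [Comp add_rec [Proj 0, Proj 1]]) [n, triangle n] (Suc (n + triangle n))"
    by (rule rec_eval_Comp1[OF rec_eval_Comp2[OF rec_eval_Proj rec_eval_Proj rec_eval_add] rec_eval.Succ])
      simp_all
  with Suc show ?case by (auto intro: rec_eval.Prec_Suc simp: add.commute)
qed

definition "pair_rec = Comp add_rec [Comp triangle_rec [add_rec], Proj 0]"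

lemma rec_eval_pair: "rec_eval pair_rec [m, n] (prod_encode (m, n))"
  unfolding pair_rec_def prod_encode_def split
  by (rule rec_eval_Comp2[OF rec_eval_Comp1[OF rec_eval_add rec_eval_triangle] rec_eval_Proj rec_eval_add])
    simp_all

definition "cons_rec f g = Comp Succ [Comp pair_rec [f, g]]"

lemma rec_eval_cons:
  "rec_eval f xs y \<Longrightarrow> rec_eval g xs (list_encode ys) \<Longrightarrow>
    rec_eval (cons_rec f g) xs (list_encode (y # ys))"
  unfolding cons_rec_def list_encode.simps
  by (rule rec_eval_Comp1[OF rec_eval_Comp2[OF _ _ rec_eval_pair] rec_eval.Succ])

definition "list_rec fs = foldr cons_rec fs Zero"

lemma rec_eval_list:
  "list_all2 (\<lambda>f y. rec_eval f xs y) fs ys \<Longrightarrow> rec_eval (list_rec fs) xs (list_encode ys)"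
  by (induction rule: list_all2_induct)
    (auto simp: list_rec_def intro: rec_eval.Zero rec_eval_cons simp del: list_encode.simps(2))

definition "double_rec f = Comp add_rec [f, f]"

lemma rec_eval_double: "rec_eval f xs y \<Longrightarrow> rec_eval (double_rec f) xs (2 * y)"
  unfolding double_rec_def mult_2 by (rule rec_eval_Comp2[OF _ _ rec_eval_add])

text \<open>Even numbers are reserved for singleton stacks, so that names along the unary path are
  computed by doubling; all other nodes get odd names.\<close>

definition name :: "node \<Rightarrow> nat" where
  "name u = (case u of Stack [i] \<Rightarrow> 2 * i | _ \<Rightarrow> Suc (2 * to_nat u))"

lemma name_Stack [simp]: "name (Stack [i]) = 2 * i"
  by (simp add: name_def)

lemma inj_name: "inj name"
proof (rule injI)
  have cases: "(\<exists>i. u = Stack [i] \<and> name u = 2 * i) \<or> name u = Suc (2 * to_nat u)" for u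
    by (simp add: name_def split: node.split list.split)
  fix u v assume "name u = name v"
  then show "u = v"
    using cases[of u] cases[of v] by (auto dest: arg_cong[where f = even])
qed

definition fact_code :: "node fact \<Rightarrow> nat" where
  "fact_code \<alpha> = prod_encode (fst \<alpha>, list_encode (map name (snd \<alpha>)))"

definition edge_rec :: "letter \<Rightarrow> recf \<Rightarrow> letter \<Rightarrow> recf \<Rightarrow> recf" where
  "edge_rec b f a h = Comp pair_rec [Zero, list_rec [const_rec (name (Letter Link)),
     const_rec (name (Letter b)), f, const_rec (name (Letter a)), h]]"

lemma rec_eval_edge:
  assumes "prev_letter D a = b" "rec_eval f xs (name u)" "rec_eval h xs (name w)"
  shows "rec_eval (edge_rec b f a h) xs (fact_code (edge D u a w))"
  unfolding edge_rec_def fact_code_def edge_def fst_conv snd_conv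
  by (rule rec_eval_Comp2[OF rec_eval.Zero rec_eval_list rec_eval_pair])
    (simp add: assms rec_eval_const)

definition "chain_rec = Prec (Proj 0) (cons_rec
  (edge_rec (Code Push) (double_rec (Proj 0)) (Code Incr) (double_rec (Comp Succ [Proj 0]))) (Proj 1))"

text \<open>The argument serves twice, as the length of the path and as the code of the list that
  follows it. So the whole input is computed from \<open>n\<close> by a function in which the
  program does not occur.\<close>

definition "input_rec = cons_rec
  (edge_rec (Code Incr) (double_rec (Proj 0)) Main (const_rec 2)) (Comp chain_rec [Proj 0, Proj 0])"

lemma rec_eval_chain:
  "rec_eval chain_rec [k, list_encode (map fact_code fs)]
    (list_encode (map fact_code
      (rev (map (\<lambda>i. edge D (Stack [i]) (Code Incr) (Stack [Suc i])) [0..<k]) @ fs)))"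
  unfolding chain_rec_def
proof (induction k)
  case 0
  show ?case by (intro rec_eval.Prec_0 rec_eval_Proj) simp_all
next
  case (Suc k)
  show ?case
    by (rule rec_eval.Prec_Suc[OF Suc], simp only: upt_Suc_append le0 map_append rev_append list.map
        rev.simps append.simps, rule rec_eval_cons[OF rec_eval_edge])
      (auto intro!: rec_eval_double rec_eval_Proj rec_eval_Comp1[OF _ rec_eval.Succ]
        simp del: mult_Suc_right simp: rev_map)
qed

lemma rec_eval_input:
  assumes "n = list_encode (map fact_code (base D))"
  shows "rec_eval input_rec [n] (list_encode (map fact_code (input D n)))"
  unfolding input_rec_def input_def list.map
  using rec_eval_chain[of n "base D" D, folded assms]
  by (intro rec_eval_cons[OF rec_eval_edge] rec_eval_Comp2[where y = n and z = n])
    (auto intro!: rec_eval_double rec_eval_Proj simp: assms[symmetric] rec_eval_const[of 2])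

theorem theorem12:
  shows "\<exists>(\<sigma>B :: signature) (\<sigma>D :: signature) (lt :: nat) (C :: fm set) (Q :: fm).
           finite (dom \<sigma>B) \<and> \<sigma>D = [lt \<mapsto> 2] \<and> dom \<sigma>B \<inter> dom \<sigma>D = {} \<and>
           finite C \<and> (\<forall>\<phi>\<in>C. inclusion_dependency_over \<sigma>B \<phi>) \<and>
           cq_over (\<sigma>B ++ \<sigma>D) Q \<and>
           (\<forall>e :: nat \<Rightarrow> 'a. inj e \<longrightarrow> \<not> QA_lin_decidable e \<sigma>B \<sigma>D C Q)"
proof -
  have undecidable: "\<not> QA_lin_decidable e base_sig order_sig constraints query"
    if e: "inj e" for e :: "nat \<Rightarrow> 'a"
  proof
    assume "QA_lin_decidable e base_sig order_sig constraints query"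
    then obtain f where f: "\<And>fs. \<forall>\<alpha>\<in>set fs. fact_over (base_sig ++ order_sig) \<alpha> \<Longrightarrow>
        rec_eval f [encode_facts fs]
          (if QA_lin base_sig order_sig (facts_of e fs) constraints query then 1 else 0)"
      unfolding QA_lin_decidable_def decidable_via_def by auto
    \<comment> \<open>Compiled programs keep their argument; \<open>Dip drop1\<close> removes it
      from below the result.\<close>
    define D where "D = Seq (compile (Comp f [input_rec])) (Dip drop1)"
    \<comment> \<open>No circularity arises: \<open>D\<close> is fixed before \<open>n\<close>, and
      \<open>base D\<close> does not mention \<open>n\<close>.\<close>
    define n where "n = list_encode (map fact_code (base D))"
    define fs where "fs = map (\<lambda>(R, us). (R, map name us)) (input D n)"
    define r :: nat where
      "r = (if QA_lin base_sig order_sig (map_facts (e \<circ> name) (set (input D n))) constraints query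
        then 1 else 0)"
    have code: "encode_facts fs = list_encode (map fact_code (input D n))"
      unfolding encode_facts_def fs_def fact_code_def by (simp add: comp_def case_prod_beta)
    have facts: "facts_of e fs = map_facts (e \<circ> name) (set (input D n))"
      unfolding facts_of_def fs_def map_facts_def by (simp add: image_image case_prod_beta)
    have "\<forall>\<alpha>\<in>set fs. fact_over (base_sig ++ order_sig) \<alpha>"
      using input_over by (auto simp: fs_def fact_over_def)
    from f[OF this] have "rec_eval f [list_encode (map fact_code (input D n))] r"
      unfolding code facts r_def .
    with rec_eval_input[OF n_def] have "rec_eval (Comp f [input_rec]) [n] r"
      by (rule rec_eval_Comp1)
    from run_compile[OF this, of "[]"] have "run D [n] [r]"
      unfolding D_def by (auto intro: run.Seq run.Dip run_drop1)
    then show False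
      using QA_lin_value[of "e \<circ> name" D n] e inj_name inj_compose unfolding r_def by blast
  qed
  show ?thesis
    by (rule exI[of _ base_sig], rule exI[of _ order_sig], rule exI[of _ 2],
        rule exI[of _ constraints], rule exI[of _ query])
      (use undecidable constraints_inclusion cq_query in
        \<open>auto simp: sig_defs constraints_def\<close>)
qed

end
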